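(* Consider a sequence of degree sequences $d=(d_1,\ldots,d_n)$ with $d_1\le\cdots\le d_n$, each realisable by at least one simple graph, with $n$ vertices, $m=\frac12\sum_id_i\to\infty$ edges and maximum degree $d_n=o(\sqrt m)$. Run the Expand and Contract algorithm for graphs with degree sequence $d$ described in the context. Then, with probability tending to $1$, the algorithm terminates after at most $(1+o(1))\frac23\, m\log d_n$ steps of the contraction phase (step (2)).
   Context: Configuration-model procedure (Algorithm B): split vertex $i$ into $d_i$ edge-endpoints, choose a uniformly random perfect matching of the $2m$ edge-endpoints, and collapse groups back into vertices, giving a random labelled multigraph (loops and multiple edges allowed) with degree sequence $d$. Bad edges of a multigraph: with $\mathrm{mult}(i,j)$ the number of edges between $i$ and $j$ (loops when $i=j$), the badness is $\sum_i\mathrm{mult}(i,i)+\sum_{i<j}\max(\mathrm{mult}(i,j)-1,0)$. A 3-swap: given three distinct edges of the multigraph, written with a chosen ordering and orientation as $(a,b),(c,d),(e,f)$, remove them and add edges $(b,c),(d,e),(f,a)$; this preserves the degree sequence, and each set of three edges admits 8 distinct 3-swaps. Algorithm: (1) generate $X_0$ by the configuration-model procedure; (2) at each step, choose three distinct edges uniformly at random and a uniformly random one of the 8 corresponding 3-swaps, and apply it unless it increases the number of bad edges (in which case the state is unchanged); (3) stop when the multigraph is simple (has no bad edges) and output it.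
   Formalization: The formal theorem additionally assumes that the maximum degree d_n tends to infinity; without this the claim fails, e.g. when all d_i = 2, since a loop in the initial multigraph survives the stated number of steps with probability bounded away from 0. *)

theory Defs
  imports
    "HOL-Probability.Probability"
    "HOL-Library.Landau_Symbols"
    "HOL-Library.Disjoint_Sets"
    "HOL-Library.Multiset"
begin

text \<open>
  A degree sequence is a list; vertex \<open>i\<close> has degree \<open>d ! i\<close>, with vertices numbered from 0.
\<close>

definition graphical :: "nat list \<Rightarrow> bool" where
  "graphical d \<longleftrightarrow>
     (\<exists>E. E \<subseteq> {e. e \<subseteq> {..<length d} \<and> card e = 2} \<and>
          (\<forall>i<length d. card {e \<in> E. i \<in> e} = d ! i))"

definition num_edges :: "nat list \<Rightarrow> real" where
  "num_edges d = real (sum_list d) / 2"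

text \<open>
  The endpoint \<open>(i, k)\<close> is the \<open>k\<close>-th edge-endpoint of vertex \<open>i\<close>. The process is run on multigraphs
  in half-edge form: a multigraph is the set of its edges, each edge being the set of its two
  endpoints, so loops and parallel edges are distinct elements of this set and the two ends of a loop
  are distinguished. Forgetting the endpoint names is \<open>collapse\<close>; there an edge is a vertex pair
  \<open>{i, j}\<close>, a loop at \<open>i\<close> being \<open>{i}\<close>. Choosing edges and swaps uniformly does not refer to the
  names, and badness depends on the collapsed multigraph only.
\<close>

type_synonym endpoint = "nat \<times> nat"

definition endpoints :: "nat list \<Rightarrow> endpoint set" where
  "endpoints d = {(i, k). i < length d \<and> k < d ! i}"

definition perfect_matchings :: "'a set \<Rightarrow> 'a set set set" where
  "perfect_matchings A = {M. partition_on A M \<and> (\<forall>e\<in>M. card e = 2)}"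

definition collapse :: "endpoint set set \<Rightarrow> nat set multiset" where
  "collapse G = image_mset (\<lambda>e. fst ` e) (mset_set G)"

definition edge_mult :: "nat set multiset \<Rightarrow> nat \<Rightarrow> nat \<Rightarrow> nat" where
  "edge_mult H i j = count H {i, j}"

text \<open>The truncated subtraction on \<open>nat\<close> is intended: it is \<open>max (edge_mult H i j - 1) 0\<close>.\<close>

definition badness :: "nat \<Rightarrow> nat set multiset \<Rightarrow> nat" where
  "badness n H = (\<Sum>i<n. edge_mult H i i) + (\<Sum>j<n. \<Sum>i<j. edge_mult H i j - 1)"

text \<open>
  For three edges \<open>T\<close> of \<open>G\<close>, the 48 orderings and orientations of \<open>T\<close> yield 8 distinct swaps
  (rotating, or reversing, the cyclic presentation gives the same swap).
\<close>

definition three_swaps :: "endpoint set set \<Rightarrow> endpoint set set \<Rightarrow> endpoint set set set" where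
  "three_swaps G T =
     {(G - T) \<union> {{b, c}, {d, e}, {f, a}} | a b c d e f. T = {{a, b}, {c, d}, {e, f}}}"

text \<open>
  With fewer than three edges there is no triple to choose and a step from a non-simple state has
  an unspecified distribution. A simple state is never left.
\<close>

definition contraction_step :: "nat \<Rightarrow> endpoint set set \<Rightarrow> endpoint set set pmf" where
  "contraction_step n G =
     (if badness n (collapse G) = 0 then return_pmf G
      else do {
        T \<leftarrow> pmf_of_set {T. T \<subseteq> G \<and> card T = 3};
        G' \<leftarrow> pmf_of_set (three_swaps G T);
        return_pmf (if badness n (collapse G') > badness n (collapse G) then G else G')
      })"

primrec expand_contract :: "nat list \<Rightarrow> nat \<Rightarrow> endpoint set set pmf" where
  "expand_contract d 0 = pmf_of_set (perfect_matchings (endpoints d))"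
| "expand_contract d (Suc t) = expand_contract d t \<bind> contraction_step (length d)"

text \<open>
  The probability that the contraction phase stops after at most \<open>x \<ge> 0\<close> steps; as simple states
  are absorbing, this is the probability of being in a simple state after \<open>\<lfloor>x\<rfloor>\<close> steps.
\<close>

definition prob_terminates_within :: "nat list \<Rightarrow> real \<Rightarrow> real" where
  "prob_terminates_within d x =
     measure_pmf.prob (expand_contract d (nat \<lfloor>x\<rfloor>)) {G. badness (length d) (collapse G) = 0}"

end

(*
  The badness of G equals the number of edges minus the number of vertex pairs joined by an edge, so
  it is also the number of edges outside a transversal S of the non-loop parallel classes. If the
  three edges of T pairwise have distance at least 2 in the collapsed graph, then each of the 8 swaps
  of T joins three new vertex pairs, and the badness drops by at least |T - S|. Each edge has distance
  at most 1 from only O(D^2) edges, where D is the maximum degree, so a step multiplies the expected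
  badness by at most 1 - (3/m) (1 - O(D^2/m)). The expected initial badness is O(D^2), as the expected
  number of loops and parallel pairs in a random matching shows. Hence the expected badness after
  (1 + eps) (2/3) m ln D steps is about D^(-2 eps), and Markov's inequality applies; eps is chosen as
  (1 + 1/sqrt (ln D)) / (1 - O(D^2/m)) - 1.
*)
theory Submission
  imports Defs
begin

section \<open>Perfect matchings\<close>

lemma perfect_matchings_finite: "finite A \<Longrightarrow> finite (perfect_matchings A)"
  unfolding perfect_matchings_def
  by (rule finite_subset[OF _ finitely_many_partition_on[of A]]) auto

lemma perfect_matching_finite: "finite A \<Longrightarrow> M \<in> perfect_matchings A \<Longrightarrow> finite M"
  unfolding perfect_matchings_def using finite_elements by auto

lemma perfect_matching_card2: "M \<in> perfect_matchings A \<Longrightarrow> e \<in> M \<Longrightarrow> card e = 2"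
  unfolding perfect_matchings_def by auto

lemma perfect_matching_Union: "M \<in> perfect_matchings A \<Longrightarrow> \<Union>M = A"
  unfolding perfect_matchings_def using partition_onD1 by auto

lemma perfect_matching_unique:
  assumes "M \<in> perfect_matchings A" "e \<in> M" "f \<in> M" "x \<in> e" "x \<in> f"
  shows "e = f"
  using assms unfolding perfect_matchings_def by (auto simp: partition_on_def disjoint_def)

lemma perfect_matching_card:
  assumes "finite A" "M \<in> perfect_matchings A"
  shows "card A = 2 * card M"
proof -
  have "(\<Sum>e\<in>M. card e) = (\<Sum>e\<in>M. 2)"
    using assms(2) by (intro sum.cong) (auto simp: perfect_matching_card2)
  moreover have "card A = (\<Sum>e\<in>M. card e)"
    using assms unfolding perfect_matchings_def
    by (intro product_partition) (auto intro: card_ge_0_finite)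
  ultimately show ?thesis by simp
qed

text \<open>Works in both directions: it peels an edge off a matching, and it puts the new edges of
  a swap back in one at a time.\<close>

lemma perfect_matchings_insert:
  assumes "card e = 2" "disjnt e (\<Union>M)"
  shows "insert e M \<in> perfect_matchings A \<longleftrightarrow> M \<in> perfect_matchings (A - e) \<and> e \<subseteq> A"
  using assms unfolding perfect_matchings_def by (auto simp: partition_on_insert)

lemma perfect_matchings_remove:
  assumes "M \<in> perfect_matchings A" "e \<in> M"
  shows "M - {e} \<in> perfect_matchings (A - e)" "e \<subseteq> A"
proof -
  have d: "disjnt e (\<Union>(M - {e}))"
    using assms perfect_matching_unique[OF assms(1)] by (fastforce simp: disjnt_iff)
  have "insert e (M - {e}) \<in> perfect_matchings A"
    using assms by (simp add: insert_absorb)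
  then show "M - {e} \<in> perfect_matchings (A - e)" "e \<subseteq> A"
    using perfect_matchings_insert[OF perfect_matching_card2[OF assms] d] by auto
qed

section \<open>Counting perfect matchings that contain given edges\<close>

lemma card_perfect_matchings_containing:
  assumes "card e = 2" "e \<subseteq> A"
  shows "card {M \<in> perfect_matchings A. e \<in> M \<and> P (M - {e})} = card {M \<in> perfect_matchings (A - e). P M}"
proof -
  have e: "e \<noteq> {}" using assms(1) by auto
  have ne: "disjnt e (\<Union>M) \<and> e \<notin> M" if "M \<in> perfect_matchings (A - e)" for M
    using perfect_matching_Union[OF that] e by (auto simp: disjnt_iff)
  \<comment> \<open>Deleting \<open>e\<close> inverts \<open>insert e\<close>. Carrying a predicate
    \<open>P\<close> on the remaining edges allows a second prescribed edge to be imposed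
    later.\<close>
  have "bij_betw (insert e) {M \<in> perfect_matchings (A - e). P M}
          {M \<in> perfect_matchings A. e \<in> M \<and> P (M - {e})}"
  proof (rule bij_betw_byWitness[where f' = "\<lambda>M. M - {e}"])
    show "insert e ` {M \<in> perfect_matchings (A - e). P M}
        \<subseteq> {M \<in> perfect_matchings A. e \<in> M \<and> P (M - {e})}"
      using ne assms by (auto simp: perfect_matchings_insert)
    show "(\<lambda>M. M - {e}) ` {M \<in> perfect_matchings A. e \<in> M \<and> P (M - {e})}
        \<subseteq> {M \<in> perfect_matchings (A - e). P M}"
      by (auto intro: perfect_matchings_remove)
  qed (use ne in auto)
  then show ?thesis by (auto dest: bij_betw_same_card)
qed

lemma perfect_matching_partner:
  assumes "M \<in> perfect_matchings A" "u \<in> A"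
  shows "\<exists>v\<in>A - {u}. {u, v} \<in> M"
proof -
  obtain e where e: "e \<in> M" "u \<in> e"
    using perfect_matching_Union[OF assms(1)] assms(2) by auto
  moreover obtain v where "e = {u, v}" "u \<noteq> v"
    using perfect_matching_card2[OF assms(1) e(1)] e(2) by (auto simp: card_2_iff doubleton_eq_iff)
  ultimately show ?thesis using perfect_matching_Union[OF assms(1)] by auto
qed

text \<open>The double factorial (2k-1)!!: fix a point \<open>u\<close> and split by its partner
  \<open>v\<close>. The partner has 2k-1 choices, each leaving 2k-2 points to be matched.\<close>

lemma card_perfect_matchings:
  assumes "finite A" "card A = 2 * k"
  shows "card (perfect_matchings A) = (\<Prod>i<k. 2 * i + 1)"
  using assms
proof (induction k arbitrary: A)
  case 0
  then have "perfect_matchings A = {{}}"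
    by (auto simp: perfect_matchings_def partition_on_empty)
  then show ?case by simp
next
  case (Suc k)
  then obtain u where u: "u \<in> A" by fastforce
  have eq: "perfect_matchings A = (\<Union>v\<in>A - {u}. {M \<in> perfect_matchings A. {u, v} \<in> M})"
    using perfect_matching_partner[OF _ u] by fastforce
  have "card (perfect_matchings A) = (\<Sum>v\<in>A - {u}. card {M \<in> perfect_matchings A. {u, v} \<in> M})"
  proof (subst eq, rule card_UN_disjoint)
    show "\<forall>v\<in>A - {u}. \<forall>w\<in>A - {u}. v \<noteq> w \<longrightarrow>
      {M \<in> perfect_matchings A. {u, v} \<in> M} \<inter> {M \<in> perfect_matchings A. {u, w} \<in> M} = {}"
    proof (intro ballI impI)
      fix v w assume "v \<in> A - {u}" "w \<in> A - {u}" "v \<noteq> w"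
      then have "{u, v} \<noteq> {u, w}" by (auto simp: doubleton_eq_iff)
      then show "{M \<in> perfect_matchings A. {u, v} \<in> M} \<inter> {M \<in> perfect_matchings A. {u, w} \<in> M} = {}"
        using perfect_matching_unique[of _ A "{u, v}" "{u, w}" u] by auto
    qed
  qed (use Suc.prems in \<open>auto simp: perfect_matchings_finite\<close>)
  also have "\<dots> = (\<Sum>v\<in>A - {u}. \<Prod>i<k. 2 * i + 1)"
  proof (rule sum.cong[OF refl])
    fix v assume v: "v \<in> A - {u}"
    then have "card (A - {u, v}) = 2 * k" "card {u, v} = 2"
      using Suc.prems u by (auto simp: card_Diff_subset)
    then show "card {M \<in> perfect_matchings A. {u, v} \<in> M} = (\<Prod>i<k. 2 * i + 1)"
      using card_perfect_matchings_containing[of "{u, v}" A "\<lambda>_. True"] Suc.IH[of "A - {u, v}"]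
        u v Suc.prems by auto
  qed
  also have "\<dots> = (\<Prod>i<Suc k. 2 * i + 1)"
    using Suc.prems u by simp
  finally show ?case .
qed

lemma perfect_matchings_nonempty:
  assumes "finite A" "card A = 2 * k"
  shows "perfect_matchings A \<noteq> {}"
proof -
  have "card (perfect_matchings A) > 0"
    unfolding card_perfect_matchings[OF assms] by (rule prod_pos) simp
  then show ?thesis by auto
qed

text \<open>The quotient of two consecutive double factorials; in a uniform matching, two given
  points are partners with probability 1/(2k-1).\<close>

lemma card_perfect_matchings_pair:
  assumes "finite A" "card A = 2 * k" "u \<in> A" "v \<in> A" "u \<noteq> v"
  shows "real (card {M \<in> perfect_matchings A. {u, v} \<in> M}) =
    card (perfect_matchings A) / (2 * real k - 1)"
proof -
  obtain j where k: "k = Suc j"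
    using assms by (cases k) auto
  have e: "card {u, v} = 2" "{u, v} \<subseteq> A" and c: "card (A - {u, v}) = 2 * j"
    using assms k by (auto simp: card_Diff_subset)
  have "card {M \<in> perfect_matchings A. {u, v} \<in> M} = (\<Prod>i<j. 2 * i + 1)"
    using card_perfect_matchings_containing[OF e, of "\<lambda>_. True"]
      card_perfect_matchings[OF _ c] assms(1) by simp
  moreover have "card (perfect_matchings A) = (\<Prod>i<j. 2 * i + 1) * (2 * j + 1)"
    using card_perfect_matchings[OF assms(1,2)] k by simp
  moreover have "2 * real k - 1 = real (2 * j + 1)" using k by simp
  ultimately show ?thesis by (simp only: of_nat_mult) simp
qed

text \<open>Removing the first pair leaves a uniform matching problem on 2k-2 points, where the
  previous count gives the second factor 2k-3.\<close>

lemma card_perfect_matchings_two_pairs: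
  assumes "finite A" "card A = 2 * k" "{u, v} \<subseteq> A" "{w, z} \<subseteq> A" "distinct [u, v, w, z]"
  shows "real (card {M \<in> perfect_matchings A. {u, v} \<in> M \<and> {w, z} \<in> M}) =
    card (perfect_matchings A) / ((2 * real k - 1) * (2 * real k - 3))"
proof -
  obtain j where k: "k = Suc j"
    using assms by (cases k) auto
  have e: "card {u, v} = 2" "{u, v} \<subseteq> A" and c: "card (A - {u, v}) = 2 * j"
    using assms k by (auto simp: card_Diff_subset)
  have "{w, z} \<noteq> {u, v}" using assms(5) by (auto simp: doubleton_eq_iff)
  then have "card {M \<in> perfect_matchings A. {u, v} \<in> M \<and> {w, z} \<in> M}
      = card {M \<in> perfect_matchings (A - {u, v}). {w, z} \<in> M}"
    using card_perfect_matchings_containing[OF e, of "\<lambda>M. {w, z} \<in> M"] by simp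
  moreover have "real (card {M \<in> perfect_matchings (A - {u, v}). {w, z} \<in> M})
      = card (perfect_matchings (A - {u, v})) / (2 * real j - 1)"
    using assms c by (intro card_perfect_matchings_pair) auto
  moreover have "card (perfect_matchings A) = card (perfect_matchings (A - {u, v})) * (2 * j + 1)"
    using card_perfect_matchings[OF assms(1,2)] card_perfect_matchings[OF _ c] assms(1) k by simp
  then have "real (card (perfect_matchings A)) = card (perfect_matchings (A - {u, v})) * (2 * real k - 1)"
    using k by (simp add: algebra_simps)
  moreover have "2 * real k - 3 = 2 * real j - 1" "2 * real k - 1 \<noteq> 0" using k by auto
  ultimately show ?thesis by simp
qed

section \<open>Badness and 3-swaps\<close>

text \<open>The edge set of the simple graph underlying the collapsed multigraph; a loop has a
  singleton image and drops out.\<close>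

definition vertex_pairs :: "endpoint set set \<Rightarrow> nat set set" where
  "vertex_pairs G = {s \<in> (\<lambda>e. fst ` e) ` G. card s = 2}"

text \<open>A vertex pair carrying c > 0 parallel edges contributes c-1 to the badness and 1 to
  \<open>vertex_pairs G\<close>, and a loop contributes 1 to the badness only. Together every edge
  is counted once.\<close>

lemma badness_plus_card_vertex_pairs:
  assumes fin: "finite G" and two: "\<And>e. e \<in> G \<Longrightarrow> card e = 2" and vert: "fst ` \<Union>G \<subseteq> {..<n}"
  shows "badness n (collapse G) + card (vertex_pairs G) = card G"
proof -
  define c where "c s = card {e \<in> G. fst ` e = s}" for s
  define L where "L = (\<lambda>i. {i}) ` {..<n}"
  \<comment> \<open>\<open>L\<close> holds the possible loop images and \<open>P\<close> the
    possible proper pairs; \<open>Q\<close> indexes \<open>P\<close> with the larger vertex first,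
    matching the nested sum in \<open>badness\<close>.\<close>
  define Q where "Q = (SIGMA j:{..<n}. {..<j})"
  define P where "P = (\<lambda>(j, i). {i, j}) ` Q"
  have count: "count (collapse G) s = c s" for s
    unfolding collapse_def c_def using fin
    by (auto simp: count_image_mset sum_mset_def intro!: arg_cong[where f = card])
  have injL: "inj_on (\<lambda>i. {i}) {..<n}" and injP: "inj_on (\<lambda>(j, i). {i, j}) Q"
    by (auto simp: inj_on_def Q_def doubleton_eq_iff)
  have finLP: "finite L" "finite P" by (auto simp: L_def P_def Q_def)
  have P2: "card s = 2" if "s \<in> P" for s using that by (auto simp: P_def Q_def)
  have L1: "card s = 1" if "s \<in> L" for s using that by (auto simp: L_def)
  have disj: "L \<inter> P = {}" using P2 L1 by fastforce
  have image: "fst ` e \<in> L \<union> P" if e: "e \<in> G" for e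
  proof -
    obtain x y where xy: "e = {x, y}" using two[OF e] by (auto simp: card_2_iff)
    then have "fst x < n" "fst y < n" using vert e by auto
    then consider "fst x = fst y" | "(fst y, fst x) \<in> Q" | "(fst x, fst y) \<in> Q"
      unfolding Q_def by fastforce
    then show ?thesis
    proof cases
      case 1 then show ?thesis using xy \<open>fst x < n\<close> by (auto simp: L_def)
    next
      case 2
      then have "(\<lambda>(j, i). {i, j}) (fst y, fst x) \<in> P" unfolding P_def by (rule imageI)
      then show ?thesis using xy by (auto simp: insert_commute)
    next
      case 3
      then have "(\<lambda>(j, i). {i, j}) (fst x, fst y) \<in> P" unfolding P_def by (rule imageI)
      then show ?thesis using xy by (auto simp: insert_commute)
    qed
  qed
  have "card G = (\<Sum>s\<in>L \<union> P. c s)"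
  proof -
    have "(\<Sum>s\<in>L \<union> P. \<Sum>e\<in>{e \<in> G. fst ` e = s}. 1) = (\<Sum>e\<in>G. 1::nat)"
      by (rule sum.group) (use fin finLP image in auto)
    then show ?thesis by (simp add: c_def)
  qed
  also have "\<dots> = (\<Sum>s\<in>L. c s) + (\<Sum>s\<in>P. c s)"
    using finLP disj by (rule sum.union_disjoint)
  \<comment> \<open>With truncated subtraction, c = (c - 1) + 1 holds only for c > 0, so the
    correction term counts exactly the occupied pairs.\<close>
  also have "(\<Sum>s\<in>P. c s) = (\<Sum>s\<in>P. (c s - 1) + (if 0 < c s then 1 else 0))"
    by (rule sum.cong) auto
  also have "\<dots> = (\<Sum>s\<in>P. c s - 1) + card {s \<in> P. 0 < c s}"
    using finLP by (simp add: sum.distrib sum.If_cases Int_def)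
  also have "{s \<in> P. 0 < c s} = vertex_pairs G"
  proof -
    have "0 < c s \<longleftrightarrow> s \<in> (\<lambda>e. fst ` e) ` G" for s
      unfolding c_def using fin by (auto simp: card_gt_0_iff)
    then show ?thesis
      unfolding vertex_pairs_def using image P2 L1 by fastforce
  qed
  finally have "card G = (\<Sum>s\<in>L. c s) + (\<Sum>s\<in>P. c s - 1) + card (vertex_pairs G)" by simp
  moreover have "badness n (collapse G) = (\<Sum>s\<in>L. c s) + (\<Sum>s\<in>P. c s - 1)"
    unfolding badness_def edge_mult_def count L_def P_def Q_def
    using injL injP[unfolded Q_def]
    by (simp add: sum.reindex sum.Sigma case_prod_unfold)
  ultimately show ?thesis by simp
qed

section \<open>3-swaps of perfect matchings\<close>

lemma three_swapsE:
  assumes G: "G \<in> perfect_matchings A" and "T \<subseteq> G" "card T = 3" "G' \<in> three_swaps G T"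
  obtains a b c d e f where "T = {{a, b}, {c, d}, {e, f}}" "distinct [a, b, c, d, e, f]"
    "G' = G - T \<union> {{b, c}, {d, e}, {f, a}}"
proof -
  obtain a b c d e f where T: "T = {{a, b}, {c, d}, {e, f}}"
    and G': "G' = G - T \<union> {{b, c}, {d, e}, {f, a}}"
    using assms(4) unfolding three_swaps_def by blast
  have "card {{a, b}, {c, d}, {e, f}} = 3" using T assms(3) by simp
  \<comment> \<open>The three edges differ, hence are disjoint blocks of the matching, and each
    block has two elements; so all six endpoints are distinct.\<close>
  then have ne: "{a, b} \<noteq> {c, d}" "{a, b} \<noteq> {e, f}" "{c, d} \<noteq> {e, f}"
    by (auto simp: card_insert_if split: if_splits)
  have mem: "{a, b} \<in> G" "{c, d} \<in> G" "{e, f} \<in> G" using T assms(2) by auto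
  then have "a \<noteq> b" "c \<noteq> d" "e \<noteq> f"
    using perfect_matching_card2[OF G] by fastforce+
  moreover have "{a, b} \<inter> {c, d} = {}" "{a, b} \<inter> {e, f} = {}" "{c, d} \<inter> {e, f} = {}"
    using perfect_matching_unique[OF G] mem ne by blast+
  ultimately have "distinct [a, b, c, d, e, f]" by auto
  then show ?thesis using that T G' by blast
qed

text \<open>The three removed edges and the three added edges cover the same six endpoints, so the
  rest of \<open>G\<close> is a matching of the same remaining set in both cases.\<close>

lemma three_swaps_perfect_matching:
  assumes G: "G \<in> perfect_matchings A" and T: "T \<subseteq> G" "card T = 3" "G' \<in> three_swaps G T"
  shows "G' \<in> perfect_matchings A"
proof -
  obtain a b c d e f where T3: "T = {{a, b}, {c, d}, {e, f}}" and ds: "distinct [a, b, c, d, e, f]"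
    and G': "G' = G - T \<union> {{b, c}, {d, e}, {f, a}}"
    using three_swapsE[OF assms] .
  have ne: "{c, d} \<noteq> {a, b}" "{e, f} \<noteq> {a, b}" "{e, f} \<noteq> {c, d}"
    using ds by (auto simp: doubleton_eq_iff)
  have "G - {{a, b}} - {{c, d}} - {{e, f}} \<in> perfect_matchings (A - {a, b} - {c, d} - {e, f})"
    using T(1) T3 ne by (intro perfect_matchings_remove(1) G) auto
  moreover have "G - {{a, b}} - {{c, d}} - {{e, f}} = G - T"
    "A - {a, b} - {c, d} - {e, f} = A - {b, c} - {d, e} - {f, a}"
    using T3 by auto
  ultimately have r: "G - T \<in> perfect_matchings (A - {b, c} - {d, e} - {f, a})" by simp
  have sub: "{a, b, c, d, e, f} \<subseteq> A"
    using perfect_matchings_remove(2)[OF G] T(1) T3 by auto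
  have card_f_a: "card {f, a} = 2" and card_d_e: "card {d, e} = 2" and card_b_c: "card {b, c} = 2"
    using ds by auto
  have U: "\<Union>(G - T) = A - {b, c} - {d, e} - {f, a}"
    using perfect_matching_Union[OF r] .
  have d1: "disjnt {f, a} (\<Union>(G - T))"
    unfolding U by (auto simp: disjnt_iff)
  have 1: "insert {f, a} (G - T) \<in> perfect_matchings (A - {b, c} - {d, e})"
    unfolding perfect_matchings_insert[OF card_f_a d1] using r ds sub by auto
  have d2: "disjnt {d, e} (\<Union>(insert {f, a} (G - T)))"
    unfolding perfect_matching_Union[OF 1] by (auto simp: disjnt_iff)
  have 2: "insert {d, e} (insert {f, a} (G - T)) \<in> perfect_matchings (A - {b, c})"
    unfolding perfect_matchings_insert[OF card_d_e d2] using 1 ds sub by auto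
  have d3: "disjnt {b, c} (\<Union>(insert {d, e} (insert {f, a} (G - T))))"
    unfolding perfect_matching_Union[OF 2] by (auto simp: disjnt_iff)
  have "insert {b, c} (insert {d, e} (insert {f, a} (G - T))) \<in> perfect_matchings A"
    unfolding perfect_matchings_insert[OF card_b_c d3] using 2 ds sub by auto
  then show ?thesis unfolding G' by (simp add: Un_commute)
qed

text \<open>Needed for \<open>pmf_of_set (three_swaps G T)\<close> to be a genuine uniform
  distribution.\<close>

lemma three_swaps_finite_nonempty:
  assumes G: "G \<in> perfect_matchings A" and "finite A" and T: "T \<subseteq> G" "card T = 3"
  shows "finite (three_swaps G T)" "three_swaps G T \<noteq> {}"
proof -
  have "three_swaps G T \<subseteq> perfect_matchings A"
    using three_swaps_perfect_matching[OF G T] by auto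
  then show "finite (three_swaps G T)"
    using perfect_matchings_finite[OF \<open>finite A\<close>] finite_subset by auto
  obtain x y z where xyz: "T = {x, y, z}" using T(2) by (auto simp: card_3_iff)
  have "card x = 2" "card y = 2" "card z = 2"
    using xyz T(1) perfect_matching_card2[OF G] by auto
  then obtain a b c d e f where "x = {a, b}" "y = {c, d}" "z = {e, f}"
    by (auto simp: card_2_iff)
  then show "three_swaps G T \<noteq> {}" unfolding three_swaps_def using xyz by blast
qed

text \<open>The negation says that the edges are at distance at least 2 in the collapsed graph: an
  edge joining an endpoint of one to an endpoint of the other would be neither a loop nor parallel
  to an edge of \<open>G\<close>.\<close>

definition conflict :: "endpoint set set \<Rightarrow> endpoint set \<Rightarrow> endpoint set \<Rightarrow> bool" where
  "conflict G f g \<longleftrightarrow>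
     (\<exists>u\<in>f. \<exists>v\<in>g. fst u = fst v \<or> {fst u, fst v} \<in> (\<lambda>e. fst ` e) ` G)"

definition conflict_free :: "endpoint set set \<Rightarrow> endpoint set set \<Rightarrow> bool" where
  "conflict_free G T \<longleftrightarrow> (\<forall>f\<in>T. \<forall>g\<in>T. f \<noteq> g \<longrightarrow> \<not> conflict G f g)"

text \<open>\<open>S\<close> contains one edge for each vertex pair. After the swap the pairs of
  \<open>S - T\<close> survive and three new pairs \<open>N\<close> appear, so at least |S| - |S
  \<inter> T| + 3 pairs are present, and 3 - |S \<inter> T| = |T - S|.\<close>

lemma vertex_pairs_conflict_free_swap:
  assumes G: "G \<in> perfect_matchings A" and T: "T \<subseteq> G" "card T = 3" "G' \<in> three_swaps G T"
    and free: "conflict_free G T" and "finite A"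
    and S: "S \<subseteq> G" "inj_on (\<lambda>e. fst ` e) S" "(\<lambda>e. fst ` e) ` S = vertex_pairs G"
  shows "card (vertex_pairs G) + card (T - S) \<le> card (vertex_pairs G')"
proof -
  obtain a b c d e f where T3: "T = {{a, b}, {c, d}, {e, f}}" and ds: "distinct [a, b, c, d, e, f]"
    and G': "G' = G - T \<union> {{b, c}, {d, e}, {f, a}}"
    using three_swapsE[OF assms(1-4)] .
  have finG: "finite G" using perfect_matching_finite[OF \<open>finite A\<close> G] .
  have finS: "finite S" using S(1) finG finite_subset by auto
  have ne: "{c, d} \<noteq> {a, b}" "{e, f} \<noteq> {a, b}" "{e, f} \<noteq> {c, d}"
    using ds by (auto simp: doubleton_eq_iff)
  define N where "N = {{fst b, fst c}, {fst d, fst e}, {fst f, fst a}}"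
  have nc: "\<not> conflict G {a, b} {c, d}" "\<not> conflict G {a, b} {e, f}" "\<not> conflict G {c, d} {e, f}"
    using free ne unfolding conflict_free_def T3 by auto
  \<comment> \<open>The comparisons inside \<open>{a, b}\<close>, \<open>{c, d}\<close> and
    \<open>{e, f}\<close> are left out, since an edge of \<open>T\<close> may itself be a
    loop.\<close>
  have far: "fst a \<noteq> fst c" "fst a \<noteq> fst d" "fst a \<noteq> fst e" "fst a \<noteq> fst f"
    "fst b \<noteq> fst c" "fst b \<noteq> fst d" "fst b \<noteq> fst e" "fst b \<noteq> fst f"
    "fst c \<noteq> fst e" "fst c \<noteq> fst f" "fst d \<noteq> fst e" "fst d \<noteq> fst f"
    using nc unfolding conflict_def by auto
  have new: "{fst b, fst c} \<notin> vertex_pairs G" "{fst d, fst e} \<notin> vertex_pairs G"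
    "{fst f, fst a} \<notin> vertex_pairs G"
    using nc unfolding conflict_def vertex_pairs_def by (auto simp: insert_commute)
  have "{fst b, fst c} \<noteq> {fst d, fst e}" "{fst b, fst c} \<noteq> {fst f, fst a}"
    "{fst d, fst e} \<noteq> {fst f, fst a}"
    using far by (simp_all add: doubleton_eq_iff)
  then have "card N = 3"
    unfolding N_def by simp
  have NG': "N \<subseteq> vertex_pairs G'"
    unfolding N_def vertex_pairs_def G' using far by auto
  have SG': "(\<lambda>e. fst ` e) ` (S - T) \<subseteq> vertex_pairs G'"
    using S unfolding vertex_pairs_def G' by auto
  have disj: "(\<lambda>e. fst ` e) ` (S - T) \<inter> N = {}"
    using S(3) new unfolding N_def by auto
  have finG': "finite (vertex_pairs G')"
    using finG unfolding vertex_pairs_def G' by auto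
  have "card (vertex_pairs G) = card S" using S card_image by metis
  moreover have "card S = card (S \<inter> T) + card (S - T)"
    using finS by (rule card_Int_Diff)
  moreover have "card T = card (S \<inter> T) + card (T - S)"
    using card_Int_Diff[of T S] finite_subset[OF T(1) finG] by (simp add: Int_commute)
  moreover have "card (S - T) + card N = card ((\<lambda>e. fst ` e) ` (S - T) \<union> N)"
    using disj finS card_image[OF inj_on_subset[OF S(2), of "S - T"]]
    by (subst card_Un_disjoint) (auto simp: N_def)
  moreover have "\<dots> \<le> card (vertex_pairs G')"
    using finG' NG' SG' by (intro card_mono) auto
  ultimately show ?thesis using T(2) \<open>card N = 3\<close> by linarith
qed

section \<open>Conflicting edges\<close>

text \<open>Besides \<open>i\<close> itself, every vertex in the set is that of the partner of one
  of the at most \<open>D\<close> endpoints at \<open>i\<close>.\<close>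

lemma card_neighbours:
  assumes G: "G \<in> perfect_matchings A" and "finite A"
    and deg: "\<And>i. card {x \<in> A. fst x = i} \<le> D"
  shows "finite {j. i = j \<or> {i, j} \<in> (\<lambda>e. fst ` e) ` G}" (is "finite ?N")
    and "card {j. i = j \<or> {i, j} \<in> (\<lambda>e. fst ` e) ` G} \<le> 1 + D"
proof -
  define F where "F = {x \<in> A. fst x = i}"
  \<comment> \<open>The partner of \<open>x\<close>, unique because blocks of a matching are
    disjoint.\<close>
  define p where "p x = (SOME y. {x, y} \<in> G)" for x
  have p: "p x = y" if "{x, y} \<in> G" for x y
  proof -
    have "{x, p x} \<in> G" unfolding p_def using that by (rule someI)
    then have "{x, p x} = {x, y}" using that perfect_matching_unique[OF G, of _ _ x] by simp
    moreover have "x \<noteq> y" using perfect_matching_card2[OF G that] by auto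
    ultimately show ?thesis by (auto simp: doubleton_eq_iff)
  qed
  have sub: "?N \<subseteq> insert i ((\<lambda>x. fst (p x)) ` F)"
  proof
    fix j assume "j \<in> ?N"
    then consider "j = i" | e where "e \<in> G" "fst ` e = {i, j}" by blast
    then show "j \<in> insert i ((\<lambda>x. fst (p x)) ` F)"
    proof cases
      case (2 e)
      obtain x y where xy: "e = {x, y}"
        using perfect_matching_card2[OF G 2(1)] by (auto simp: card_2_iff)
      have xyG: "{x, y} \<in> G" "{y, x} \<in> G" using 2(1) xy by (auto simp: insert_commute)
      then have "x \<in> A" "y \<in> A"
        using perfect_matching_Union[OF G] by auto
      then have "fst x = i \<Longrightarrow> fst (p x) \<in> (\<lambda>x. fst (p x)) ` F"
        and "fst y = i \<Longrightarrow> fst (p y) \<in> (\<lambda>x. fst (p x)) ` F"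
        unfolding F_def by blast+
      moreover have "fst x = i \<and> fst y = j \<or> fst y = i \<and> fst x = j"
        using 2(2) xy by (auto simp: doubleton_eq_iff)
      ultimately show ?thesis using p[OF xyG(1)] p[OF xyG(2)] by auto
    qed simp
  qed
  have fin: "finite F" using \<open>finite A\<close> by (simp add: F_def)
  then show "finite ?N" using sub by (meson finite.insertI finite_imageI finite_subset)
  have "card ?N \<le> card (insert i ((\<lambda>x. fst (p x)) ` F))"
    using sub fin by (intro card_mono) auto
  also have "\<dots> \<le> Suc (card F)"
    using fin card_image_le[OF fin, of "\<lambda>x. fst (p x)"] by (simp add: card_insert_if)
  also have "\<dots> \<le> 1 + D" using deg[of i] by (simp add: F_def)
  finally show "card ?N \<le> 1 + D" .
qed

text \<open>Each of the two ends of \<open>f\<close> has at most 1 + D vertices within distance 1,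
  each of these carries at most \<open>D\<close> endpoints, and an endpoint determines its
  edge.\<close>

lemma card_conflicts:
  assumes G: "G \<in> perfect_matchings A" and "finite A"
    and deg: "\<And>i. card {x \<in> A. fst x = i} \<le> D" and "f \<in> G"
  shows "card {g \<in> G. conflict G f g} \<le> 2 * D * (1 + D)"
proof -
  define N where "N i = {j. i = j \<or> {i, j} \<in> (\<lambda>e. fst ` e) ` G}" for i
  define F where "F j = {x \<in> A. fst x = j}" for j
  define V where "V = (\<Union>u\<in>f. \<Union>j\<in>N (fst u). F j)"
  define edge where "edge v = (SOME e. e \<in> G \<and> v \<in> e)" for v
  have edge: "edge v = g" if "g \<in> G" "v \<in> g" for v g
    using someI[of "\<lambda>e. e \<in> G \<and> v \<in> e" g] that perfect_matching_unique[OF G, of "edge v" g v]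
    unfolding edge_def by blast
  have finN: "finite (N i)" and cardN: "card (N i) \<le> 1 + D" for i
    unfolding N_def using card_neighbours[OF G \<open>finite A\<close> deg] by auto
  have finF: "finite (F j)" and cardF: "card (F j) \<le> D" for j
    unfolding F_def using \<open>finite A\<close> deg by auto
  have f2: "card f = 2" using perfect_matching_card2[OF G \<open>f \<in> G\<close>] .
  then have finf: "finite f" by (auto intro: card_ge_0_finite)
  have finV: "finite V" unfolding V_def using finf finN finF by auto
  have "{g \<in> G. conflict G f g} \<subseteq> edge ` V"
  proof
    fix g assume "g \<in> {g \<in> G. conflict G f g}"
    then obtain u v where uv: "g \<in> G" "u \<in> f" "v \<in> g" "fst v \<in> N (fst u)"
      unfolding conflict_def N_def by auto
    then have "v \<in> V"
      using perfect_matching_Union[OF G] unfolding V_def F_def by auto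
    then show "g \<in> edge ` V" using edge[OF uv(1,3)] by blast
  qed
  then have "card {g \<in> G. conflict G f g} \<le> card V"
    using card_mono[of "edge ` V" "{g \<in> G. conflict G f g}"] card_image_le[OF finV, of edge] finV by force
  also have "\<dots> \<le> (\<Sum>u\<in>f. card (\<Union>j\<in>N (fst u). F j))"
    unfolding V_def using finf by (rule card_UN_le)
  also have "\<dots> \<le> (\<Sum>u\<in>f. (1 + D) * D)"
  proof (rule sum_mono)
    fix u
    have "card (\<Union>j\<in>N (fst u). F j) \<le> (\<Sum>j\<in>N (fst u). card (F j))"
      using finN by (rule card_UN_le)
    also have "\<dots> \<le> of_nat (card (N (fst u))) * D"
      using cardF by (rule sum_bounded_above)
    also have "\<dots> \<le> (1 + D) * D"
      using mult_le_mono1[OF cardN[of "fst u"], of D] by simp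
    finally show "card (\<Union>j\<in>N (fst u). F j) \<le> (1 + D) * D" .
  qed
  also have "\<dots> = 2 * D * (1 + D)" using f2 by (simp add: algebra_simps)
  finally show ?thesis .
qed

lemma conflict_commute:
  assumes "conflict G f g"
  shows "conflict G g f"
proof -
  obtain u v where uv: "u \<in> f" "v \<in> g" "fst u = fst v \<or> {fst u, fst v} \<in> (\<lambda>e. fst ` e) ` G"
    using assms unfolding conflict_def by blast
  then have "fst v = fst u \<or> {fst v, fst u} \<in> (\<lambda>e. fst ` e) ` G"
    by (simp only: insert_commute[of "fst v"] eq_commute[of "fst v"])
  then show ?thesis using uv(1,2) unfolding conflict_def by blast
qed

text \<open>Either some other edge of the triple conflicts with \<open>e\<close> and the third edge
  is arbitrary (\<open>P1\<close>), or the two edges other than \<open>e\<close> conflict with each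
  other (\<open>P2\<close>). Each case allows at most \<open>K * card G\<close> choices.\<close>

lemma card_conflicting_triples:
  assumes "finite G" and K: "\<And>f. f \<in> G \<Longrightarrow> card {g \<in> G. conflict G f g} \<le> K" and "e \<in> G"
  shows "card {T. T \<subseteq> G \<and> card T = 3 \<and> e \<in> T \<and> \<not> conflict_free G T} \<le> 2 * K * card G"
    (is "card ?B \<le> _")
proof -
  define C where "C f = {g \<in> G. conflict G f g}" for f
  define P1 where "P1 = C e \<times> G"
  define P2 where "P2 = (SIGMA f:G. C f)"
  let ?t = "\<lambda>(f, g). {e, f, g}"
  have finC: "finite (C f)" for f using \<open>finite G\<close> by (simp add: C_def)
  then have fin: "finite P1" "finite P2" using \<open>finite G\<close> by (auto simp: P1_def P2_def)
  have "?B \<subseteq> ?t ` (P1 \<union> P2)"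
  proof
    fix T assume "T \<in> ?B"
    then have T: "T \<subseteq> G" "card T = 3" "e \<in> T" and "\<not> conflict_free G T" by auto
    then obtain f g where fg: "f \<in> T" "g \<in> T" "f \<noteq> g" "conflict G f g"
      unfolding conflict_free_def by auto
    have finT: "finite T" using T(2) by (auto intro: card_ge_0_finite)
    have "\<exists>f g. (f, g) \<in> P1 \<union> P2 \<and> {e, f, g} \<subseteq> T \<and> distinct [e, f, g]"
    proof (cases "e = f \<or> e = g")
      case True
      then obtain h where h: "h \<in> T" "h \<noteq> e" "conflict G e h"
        using fg conflict_commute by metis
      have "card (T - {e, h}) = 1" using T finT h by (simp add: card_Diff_subset)
      then obtain k where "k \<in> T - {e, h}" by (auto simp: card_1_singleton_iff)
      then show ?thesis using h T(1,3) unfolding P1_def C_def by auto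
    next
      case False
      then show ?thesis using fg T unfolding P2_def C_def by auto
    qed
    then obtain f g where h: "(f, g) \<in> P1 \<union> P2" "{e, f, g} \<subseteq> T" "distinct [e, f, g]" by auto
    then have "T = {e, f, g}"
      using card_subset_eq[OF finT h(2)] T(2) by auto
    then show "T \<in> ?t ` (P1 \<union> P2)" using h(1) by auto
  qed
  then have "card ?B \<le> card (?t ` (P1 \<union> P2))" using fin by (intro card_mono) auto
  also have "\<dots> \<le> card (P1 \<union> P2)" using fin by (intro card_image_le) auto
  also have "\<dots> \<le> card P1 + card P2" by (rule card_Un_le)
  also have "card P1 \<le> K * card G"
    unfolding P1_def using K[OF \<open>e \<in> G\<close>] by (simp add: card_cartesian_product C_def)
  also have "card P2 \<le> K * card G"
  proof -
    have "card P2 = (\<Sum>f\<in>G. card (C f))"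
      unfolding P2_def using \<open>finite G\<close> finC by simp
    also have "\<dots> \<le> of_nat (card G) * K"
      using K by (intro sum_bounded_above) (auto simp: C_def)
    finally show ?thesis by (simp add: mult.commute)
  qed
  finally show ?thesis by simp
qed

lemma card_triples_containing:
  assumes "finite G" "e \<in> G"
  shows "card {T. T \<subseteq> G \<and> card T = 3 \<and> e \<in> T} = (card G - 1) choose 2"
proof -
  have "bij_betw (insert e) {U. U \<subseteq> G - {e} \<and> card U = 2} {T. T \<subseteq> G \<and> card T = 3 \<and> e \<in> T}"
  proof (rule bij_betw_byWitness[where f' = "\<lambda>T. T - {e}"])
    show "insert e ` {U. U \<subseteq> G - {e} \<and> card U = 2} \<subseteq> {T. T \<subseteq> G \<and> card T = 3 \<and> e \<in> T}"
      using assms by (auto intro!: card_insert_disjoint[THEN trans] dest: finite_subset)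
  qed auto
  then show ?thesis
    using assms n_subsets[of "G - {e}" 2] by (auto dest: bij_betw_same_card)
qed

section \<open>Drift of the badness\<close>

text \<open>The number of edges is the same for all matchings of \<open>A\<close>, so a gain in
  vertex pairs is exactly a loss in badness.\<close>

lemma perfect_matching_badness:
  assumes "finite A" "fst ` A \<subseteq> {..<n}" "card A = 2 * m" "G \<in> perfect_matchings A"
  shows "badness n (collapse G) + card (vertex_pairs G) = m"
proof -
  have "card G = m" using perfect_matching_card[OF assms(1,4)] assms(3) by simp
  moreover have "fst ` \<Union>G \<subseteq> {..<n}" using perfect_matching_Union[OF assms(4)] assms(2) by simp
  ultimately show ?thesis
    using badness_plus_card_vertex_pairs[of G n] perfect_matching_finite[OF assms(1,4)]
      perfect_matching_card2[OF assms(4)] by simp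
qed

text \<open>For a conflict-free triple every single swap lowers the badness by at least
  \<open>card (T - S)\<close>, hence so does the average. For other triples the rejection rule
  prevents an increase.\<close>

lemma expectation_swap_le:
  assumes fin: "finite A" and vert: "fst ` A \<subseteq> {..<n}" and card: "card A = 2 * m"
    and G: "G \<in> perfect_matchings A" and T: "T \<subseteq> G" "card T = 3"
    and S: "S \<subseteq> G" "inj_on (\<lambda>e. fst ` e) S" "(\<lambda>e. fst ` e) ` S = vertex_pairs G"
  shows "measure_pmf.expectation
      (pmf_of_set (three_swaps G T) \<bind>
        (\<lambda>G'. return_pmf (if badness n (collapse G') > badness n (collapse G) then G else G')))
      (\<lambda>G'. real (badness n (collapse G')))
    \<le> real (badness n (collapse G)) - (if conflict_free G T then real (card (T - S)) else 0)"
    (is "measure_pmf.expectation (bind_pmf _ (\<lambda>G'. return_pmf (?F G'))) ?h \<le> ?R")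
proof -
  note sw = three_swaps_finite_nonempty[OF G fin T]
  have le: "?h (?F G') \<le> ?R" if G': "G' \<in> three_swaps G T" for G'
  proof (cases "conflict_free G T")
    case True
    have "card (vertex_pairs G) + card (T - S) \<le> card (vertex_pairs G')"
      using vertex_pairs_conflict_free_swap[OF G T G' True fin S] .
    then have "badness n (collapse G') + card (T - S) \<le> badness n (collapse G)"
      using perfect_matching_badness[OF fin vert card G]
        perfect_matching_badness[OF fin vert card three_swaps_perfect_matching[OF G T G']]
      by linarith
    then show ?thesis using True by simp
  qed simp
  have "measure_pmf.expectation (pmf_of_set (three_swaps G T) \<bind> (\<lambda>G'. return_pmf (?F G'))) ?h
      = (\<Sum>G'\<in>three_swaps G T. ?h (?F G')) / real (card (three_swaps G T))"
    unfolding map_pmf_def[symmetric] integral_map_pmf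
    by (rule integral_pmf_of_set[OF sw(2,1)])
  also have "\<dots> \<le> (real (card (three_swaps G T)) * ?R) / real (card (three_swaps G T))"
    by (intro divide_right_mono sum_bounded_above le) auto
  also have "\<dots> = ?R" using sw by (auto simp: card_gt_0_iff)
  finally show ?thesis .
qed

text \<open>Double counting of pairs of an edge outside \<open>S\<close> and a conflict-free triple
  containing it: the number of such edges is the badness, and each lies in all but 2 K m of the (m-1
  choose 2) triples through it, where \<open>K\<close> bounds the conflicts of one edge.\<close>

lemma contraction_step_drift:
  assumes fin: "finite A" and vert: "fst ` A \<subseteq> {..<n}" and card: "card A = 2 * m" and m: "3 \<le> m"
    and deg: "\<And>i. card {x \<in> A. fst x = i} \<le> D"
    and G: "G \<in> perfect_matchings A"
  shows "measure_pmf.expectation (contraction_step n G) (\<lambda>G'. real (badness n (collapse G')))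
    \<le> (1 - (real ((m - 1) choose 2) - real (4 * D * (1 + D) * m)) / real (m choose 3))
      * real (badness n (collapse G))" (is "?E \<le> (1 - ?q) * ?b")
proof (cases "badness n (collapse G) = 0")
  case True
  then show ?thesis by (simp add: contraction_step_def)
next
  case False
  define K where "K = 2 * D * (1 + D)"
  define Ts where "Ts = {T. T \<subseteq> G \<and> card T = 3}"
  define h where "h G' = real (badness n (collapse G'))" for G'
  have finG: "finite G" using perfect_matching_finite[OF fin G] .
  have cardG: "card G = m" using perfect_matching_card[OF fin G] card by simp
  have finTs: "finite Ts" unfolding Ts_def using finG by simp
  have cardTs: "card Ts = m choose 3" unfolding Ts_def using n_subsets[OF finG] cardG by simp
  have posTs: "0 < m choose 3" using m by (simp add: zero_less_binomial)
  then have neTs: "Ts \<noteq> {}" using cardTs by auto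
  have "vertex_pairs G \<subseteq> (\<lambda>e. fst ` e) ` G" unfolding vertex_pairs_def by auto
  \<comment> \<open>A transversal: one edge chosen for each occupied vertex pair and no loops, so
    that \<open>G - S\<close> consists of the surplus edges.\<close>
  then obtain S where S: "S \<subseteq> G" "inj_on (\<lambda>e. fst ` e) S" "vertex_pairs G = (\<lambda>e. fst ` e) ` S"
    by (auto simp: subset_image_inj)
  have bad: "card (G - S) = badness n (collapse G)"
    using perfect_matching_badness[OF fin vert card G] S cardG finG
      card_image[OF S(2)] card_Diff_subset[of S G] finite_subset[OF S(1)] by simp
  have K: "card {g \<in> G. conflict G f g} \<le> K" if "f \<in> G" for f
    unfolding K_def by (rule card_conflicts[OF G fin deg that])
  have count: "real ((m - 1) choose 2) - real (2 * K * m)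
      \<le> real (card {T \<in> Ts. conflict_free G T \<and> e \<in> T})" if e: "e \<in> G" for e
  proof -
    have "{T. T \<subseteq> G \<and> card T = 3 \<and> e \<in> T} =
        {T \<in> Ts. conflict_free G T \<and> e \<in> T} \<union>
        {T. T \<subseteq> G \<and> card T = 3 \<and> e \<in> T \<and> \<not> conflict_free G T}"
      unfolding Ts_def by auto
    then have "card {T. T \<subseteq> G \<and> card T = 3 \<and> e \<in> T} \<le> card {T \<in> Ts. conflict_free G T \<and> e \<in> T} +
        card {T. T \<subseteq> G \<and> card T = 3 \<and> e \<in> T \<and> \<not> conflict_free G T}"
      by (simp only: card_Un_le)
    then have "(m - 1) choose 2 \<le> card {T \<in> Ts. conflict_free G T \<and> e \<in> T} +
        card {T. T \<subseteq> G \<and> card T = 3 \<and> e \<in> T \<and> \<not> conflict_free G T}"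
      unfolding card_triples_containing[OF finG e] cardG .
    also have "\<dots> \<le> card {T \<in> Ts. conflict_free G T \<and> e \<in> T} + 2 * K * m"
      using card_conflicting_triples[OF finG K e] cardG by simp
    finally show ?thesis by linarith
  qed
  define W where "W T = pmf_of_set (three_swaps G T) \<bind>
    (\<lambda>G'. return_pmf (if badness n (collapse G') > badness n (collapse G) then G else G'))" for T
  have finW: "finite (set_pmf (W T))" if "T \<in> Ts" for T
    using three_swaps_finite_nonempty[OF G fin, of T] that unfolding W_def Ts_def by simp
  have step: "contraction_step n G = pmf_of_set Ts \<bind> W"
    using False unfolding contraction_step_def W_def[abs_def] Ts_def by simp
  have "?E = (\<Sum>T\<in>Ts. measure_pmf.expectation (W T) h /\<^sub>R real (card Ts))"
    unfolding step h_def[abs_def] by (rule pmf_expectation_bind_pmf_of_set[OF neTs finTs finW])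
  also have "\<dots> \<le> (\<Sum>T\<in>Ts. (?b - (if conflict_free G T then real (card (T - S)) else 0)) / real (card Ts))"
  proof (rule sum_mono)
    fix T assume "T \<in> Ts"
    then have T: "T \<subseteq> G" "card T = 3" unfolding Ts_def by auto
    show "measure_pmf.expectation
      (W T) h
      /\<^sub>R real (card Ts) \<le> (?b - (if conflict_free G T then real (card (T - S)) else 0)) / real (card Ts)"
      using divide_right_mono[OF expectation_swap_le[OF fin vert card G T S(1,2) S(3)[symmetric]],
          of "real (card Ts)"]
      unfolding h_def[abs_def] W_def by (simp add: divide_inverse mult.commute)
  qed
  also have "\<dots> = (\<Sum>T\<in>Ts. ?b - (if conflict_free G T then real (card (T - S)) else 0)) / real (card Ts)"
    by (simp only: sum_divide_distrib)
  also have "\<dots> = (card Ts * ?b - (\<Sum>T\<in>Ts. if conflict_free G T then real (card (T - S)) else 0)) / real (card Ts)"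
    by (simp add: sum_subtractf)
  also have "\<dots> \<le> (card Ts * ?b - ?b * (real ((m - 1) choose 2) - real (2 * K * m))) / real (card Ts)"
  proof -
    have "?b * (real ((m - 1) choose 2) - real (2 * K * m))
        = (\<Sum>e\<in>G - S. real ((m - 1) choose 2) - real (2 * K * m))"
      using bad by simp
    also have "\<dots> \<le> (\<Sum>e\<in>G - S. real (card {T \<in> Ts. conflict_free G T \<and> e \<in> T}))"
      using count by (intro sum_mono) auto
    also have "\<dots> = (\<Sum>e\<in>G - S. \<Sum>T\<in>Ts. if conflict_free G T \<and> e \<in> T then 1 else 0)"
      using finTs by (simp add: sum.If_cases Int_def)
    \<comment> \<open>Exchanging the sums turns the number of triples per surplus edge into the
      number of surplus edges per triple, which is the guaranteed drop.\<close>
    also have "\<dots> = (\<Sum>T\<in>Ts. \<Sum>e\<in>G - S. if conflict_free G T \<and> e \<in> T then 1 else 0)"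
      by (rule sum.swap)
    also have "\<dots> = (\<Sum>T\<in>Ts. if conflict_free G T then real (card (T - S)) else 0)"
    proof (rule sum.cong[OF refl])
      fix T assume "T \<in> Ts"
      then have "{e. e \<in> G \<and> e \<notin> S \<and> e \<in> T} = T - S" by (auto simp: Ts_def)
      then show "(\<Sum>e\<in>G - S. if conflict_free G T \<and> e \<in> T then 1 else 0)
          = (if conflict_free G T then real (card (T - S)) else 0)"
        using finG by (simp add: sum.If_cases Int_def)
    qed
    finally show ?thesis by (intro divide_right_mono) auto
  qed
  also have "\<dots> = (1 - ?q) * ?b"
    unfolding cardTs K_def using posTs by (simp add: field_simps)
  finally show ?thesis .
qed

section \<open>The initial badness\<close>

text \<open>Every edge outside a transversal \<open>S\<close> is a loop, recorded in
  \<open>L\<close>, or is parallel to the member of \<open>S\<close> with the same vertex pair,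
  recorded in \<open>Q\<close>. Ordered tuples overcount, which is harmless for an upper
  bound.\<close>

lemma badness_le_loops_parallels:
  assumes fin: "finite A" and vert: "fst ` A \<subseteq> {..<n}" and card: "card A = 2 * m"
    and M: "M \<in> perfect_matchings A"
    and L: "L = {(u, v). u \<in> A \<and> v \<in> A \<and> u \<noteq> v \<and> fst u = fst v}"
    and Q: "Q = {(u, v, w, z). {u, v, w, z} \<subseteq> A \<and> distinct [u, v, w, z] \<and> fst u = fst w \<and> fst v = fst z}"
  shows "badness n (collapse M) \<le> card {(u, v) \<in> L. {u, v} \<in> M}
    + card {(u, v, w, z) \<in> Q. {u, v} \<in> M \<and> {w, z} \<in> M}" (is "_ \<le> card ?L + card ?Q")
proof -
  have finM: "finite M" using perfect_matching_finite[OF fin M] .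
  have "finite L" by (rule finite_subset[of _ "A \<times> A"]) (use fin L in auto)
  then have finL: "finite ?L" by (rule rev_finite_subset) auto
  have "finite Q" by (rule finite_subset[of _ "A \<times> A \<times> A \<times> A"]) (use fin Q in auto)
  then have finQ: "finite ?Q" by (rule rev_finite_subset) auto
  have "vertex_pairs M \<subseteq> (\<lambda>e. fst ` e) ` M" unfolding vertex_pairs_def by auto
  then obtain S where S: "S \<subseteq> M" "inj_on (\<lambda>e. fst ` e) S" "vertex_pairs M = (\<lambda>e. fst ` e) ` S"
    by (auto simp: subset_image_inj)
  have "badness n (collapse M) = card (M - S)"
    using perfect_matching_badness[OF fin vert card M] S finM perfect_matching_card[OF fin M]
      card_image[OF S(2)] card_Diff_subset[of S M] finite_subset[OF S(1)] card by simp
  also have "M - S \<subseteq> (\<lambda>(u, v). {u, v}) ` ?L \<union> (\<lambda>(u, v, w, z). {u, v}) ` ?Q"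
  proof
    fix e assume e: "e \<in> M - S"
    then have "card e = 2" using perfect_matching_card2[OF M] by blast
    then obtain u v where uv: "e = {u, v}" "u \<noteq> v" unfolding card_2_iff by blast
    have A: "u \<in> A" "v \<in> A" using uv(1) e perfect_matching_Union[OF M] by auto
    show "e \<in> (\<lambda>(u, v). {u, v}) ` ?L \<union> (\<lambda>(u, v, w, z). {u, v}) ` ?Q"
    proof (cases "fst u = fst v")
      case True
      then have "(u, v) \<in> ?L" using A uv e L by simp
      then have "(\<lambda>(u, v). {u, v}) (u, v) \<in> (\<lambda>(u, v). {u, v}) ` ?L" by (rule imageI)
      then show ?thesis unfolding uv(1) by simp
    next
      case False
      then have "card (fst ` e) = 2" using uv by simp
      then have "fst ` e \<in> vertex_pairs M" using e unfolding vertex_pairs_def by blast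
      then obtain s where s: "s \<in> S" "fst ` e = fst ` s" using S(3) by auto
      then have sM: "s \<in> M" and "s \<noteq> e" using S(1) e by auto
      obtain w' z' where wz': "s = {w', z'}"
        using perfect_matching_card2[OF M sM] by (auto simp: card_2_iff)
      have "{fst u, fst v} = {fst w', fst z'}" using s(2) uv(1) wz' by simp
      then have "(fst u = fst w' \<and> fst v = fst z') \<or> (fst u = fst z' \<and> fst v = fst w')"
        by (simp only: doubleton_eq_iff)
      moreover have "s = {z', w'}" using wz' by (simp only: insert_commute)
      \<comment> \<open>The ends of \<open>s\<close> are named so that \<open>w\<close> lies at the
        vertex of \<open>u\<close> and \<open>z\<close> at the vertex of \<open>v\<close>.\<close>
      ultimately obtain w z where wz: "s = {w, z}" "fst u = fst w" "fst v = fst z"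
        using wz' by blast
      have "e \<inter> s = {}" using perfect_matching_unique[OF M _ sM, of e] e \<open>s \<noteq> e\<close> by blast
      then have ds: "distinct [u, v, w, z]"
        using uv wz False by auto
      have "w \<in> A" "z \<in> A" using perfect_matching_Union[OF M] sM wz(1) by auto
      then have "(u, v, w, z) \<in> ?Q" using ds wz A e sM uv(1) Q by simp
      then have "(\<lambda>(u, v, w, z). {u, v}) (u, v, w, z) \<in> (\<lambda>(u, v, w, z). {u, v}) ` ?Q" by (rule imageI)
      then show ?thesis unfolding uv(1) by simp
    qed
  qed
  then have "card (M - S) \<le> card ((\<lambda>(u, v). {u, v}) ` ?L \<union> (\<lambda>(u, v, w, z). {u, v}) ` ?Q)"
    using finL finQ by (intro card_mono) blast+
  also have "\<dots> \<le> card ((\<lambda>(u, v). {u, v}) ` ?L) + card ((\<lambda>(u, v, w, z). {u, v}) ` ?Q)"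
    by (rule card_Un_le)
  also have "\<dots> \<le> card ?L + card ?Q"
    using finL finQ by (intro add_mono card_image_le)
  finally show ?thesis .
qed

lemma sum_card_filter_swap:
  assumes "finite X" "finite Y"
  shows "(\<Sum>x\<in>X. card {y \<in> Y. R x y}) = (\<Sum>y\<in>Y. card {x \<in> X. R x y})"
  using sum_multicount_gen[OF assms, of R] by auto

text \<open>First moment: a pair in \<open>L\<close> is matched with probability 1/(2m-1), both
  pairs of a quadruple in \<open>Q\<close> with probability 1/((2m-1)(2m-3)), while |L| \<le> 2mD
  and |Q| \<le> (2mD)^2.\<close>

lemma expectation_initial_badness:
  assumes fin: "finite A" and vert: "fst ` A \<subseteq> {..<n}" and card: "card A = 2 * m" and m: "3 \<le> m"
    and deg: "\<And>i. card {x \<in> A. fst x = i} \<le> D" and "1 \<le> D"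
  shows "measure_pmf.expectation (pmf_of_set (perfect_matchings A)) (\<lambda>M. real (badness n (collapse M)))
    \<le> 4 * (real D)\<^sup>2"
proof -
  define L where "L = {(u, v). u \<in> A \<and> v \<in> A \<and> u \<noteq> v \<and> fst u = fst v}"
  define Q where "Q = {(u, v, w, z). {u, v, w, z} \<subseteq> A \<and> distinct [u, v, w, z] \<and> fst u = fst w \<and> fst v = fst z}"
  define PM where "PM = perfect_matchings A"
  define N where "N = real (card PM)"
  have finPM: "finite PM" unfolding PM_def using perfect_matchings_finite[OF fin] .
  have nePM: "PM \<noteq> {}" unfolding PM_def using perfect_matchings_nonempty[OF fin card] .
  have N: "0 < N" unfolding N_def using finPM nePM by (simp add: card_gt_0_iff)
  have finL: "finite L" by (rule finite_subset[of _ "A \<times> A"]) (use fin L_def in auto)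
  have finQ: "finite Q" by (rule finite_subset[of _ "A \<times> A \<times> A \<times> A"]) (use fin Q_def in auto)
  have cardL: "card L \<le> 2 * m * D"
  proof -
    have "card L \<le> card (SIGMA u:A. {x \<in> A. fst x = fst u})"
      using fin by (intro card_mono) (auto simp: L_def)
    also have "\<dots> = (\<Sum>u\<in>A. card {x \<in> A. fst x = fst u})"
      using fin by simp
    also have "\<dots> \<le> of_nat (card A) * D" by (intro sum_bounded_above deg)
    finally show ?thesis using card by simp
  qed
  have cardQ: "card Q \<le> (2 * m * D)\<^sup>2"
  proof -
    \<comment> \<open>Regrouping a quadruple by vertex gives two pairs of distinct endpoints at a
      common vertex, that is, two elements of \<open>L\<close>.\<close>
    have "Q \<subseteq> (\<lambda>((u, w), (v, z)). (u, v, w, z)) ` (L \<times> L)"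
    proof
      fix p assume "p \<in> Q"
      moreover obtain u v w z where p: "p = (u, v, w, z)" by (rule prod_cases4)
      ultimately have "(u, w) \<in> L" "(v, z) \<in> L" unfolding Q_def L_def by simp_all
      then have "((u, w), (v, z)) \<in> L \<times> L" by (intro SigmaI)
      then show "p \<in> (\<lambda>((u, w), (v, z)). (u, v, w, z)) ` (L \<times> L)"
        unfolding p by (rule rev_image_eqI) simp
    qed
    then have "card Q \<le> card (L \<times> L)"
      using finL by (intro surj_card_le) auto
    also have "\<dots> \<le> (2 * m * D)\<^sup>2"
      unfolding card_cartesian_product power2_eq_square using cardL by (intro mult_mono) auto
    finally show ?thesis .
  qed
  have "(\<Sum>M\<in>PM. badness n (collapse M))
      \<le> (\<Sum>M\<in>PM. card {(u, v) \<in> L. {u, v} \<in> M} + card {(u, v, w, z) \<in> Q. {u, v} \<in> M \<and> {w, z} \<in> M})"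
    unfolding PM_def by (intro sum_mono badness_le_loops_parallels[OF fin vert card _ L_def Q_def])
  also have "\<dots> = (\<Sum>M\<in>PM. card {p \<in> L. {fst p, snd p} \<in> M})
      + (\<Sum>M\<in>PM. card {p \<in> Q. {fst p, fst (snd p)} \<in> M \<and> {fst (snd (snd p)), snd (snd (snd p))} \<in> M})"
    by (simp add: sum.distrib case_prod_unfold)
  also have "(\<Sum>M\<in>PM. card {p \<in> L. {fst p, snd p} \<in> M}) = (\<Sum>p\<in>L. card {M \<in> PM. {fst p, snd p} \<in> M})"
    using finPM finL by (rule sum_card_filter_swap)
  also have "(\<Sum>M\<in>PM. card {p \<in> Q. {fst p, fst (snd p)} \<in> M \<and> {fst (snd (snd p)), snd (snd (snd p))} \<in> M})
      = (\<Sum>p\<in>Q. card {M \<in> PM. {fst p, fst (snd p)} \<in> M \<and> {fst (snd (snd p)), snd (snd (snd p))} \<in> M})"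
    using finPM finQ by (rule sum_card_filter_swap)
  finally have "real (\<Sum>M\<in>PM. badness n (collapse M))
      \<le> (\<Sum>p\<in>L. real (card {M \<in> PM. {fst p, snd p} \<in> M}))
      + (\<Sum>p\<in>Q. real (card {M \<in> PM. {fst p, fst (snd p)} \<in> M \<and> {fst (snd (snd p)), snd (snd (snd p))} \<in> M}))"
    unfolding of_nat_sum[symmetric] of_nat_add[symmetric] of_nat_le_iff .
  also have "\<dots> = (\<Sum>p\<in>L. N / (2 * real m - 1)) + (\<Sum>p\<in>Q. N / ((2 * real m - 1) * (2 * real m - 3)))"
  proof (intro arg_cong2[where f = "(+)"] sum.cong refl)
    fix p assume "p \<in> L"
    then have "fst p \<in> A" "snd p \<in> A" "fst p \<noteq> snd p" by (simp_all add: L_def case_prod_unfold)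
    then show "real (card {M \<in> PM. {fst p, snd p} \<in> M}) = N / (2 * real m - 1)"
      unfolding N_def PM_def by (rule card_perfect_matchings_pair[OF fin card])
  next
    fix p assume "p \<in> Q"
    then have "{fst p, fst (snd p)} \<subseteq> A" "{fst (snd (snd p)), snd (snd (snd p))} \<subseteq> A"
      "distinct [fst p, fst (snd p), fst (snd (snd p)), snd (snd (snd p))]"
      by (simp_all add: Q_def case_prod_unfold)
    then show "real (card {M \<in> PM. {fst p, fst (snd p)} \<in> M \<and> {fst (snd (snd p)), snd (snd (snd p))} \<in> M})
        = N / ((2 * real m - 1) * (2 * real m - 3))"
      unfolding N_def PM_def by (rule card_perfect_matchings_two_pairs[OF fin card])
  qed
  also have "\<dots> = N * (card L / (2 * real m - 1) + card Q / ((2 * real m - 1) * (2 * real m - 3)))"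
    by (simp add: algebra_simps)
  also have "\<dots> \<le> N * (4 * (real D)\<^sup>2)"
  proof (intro mult_left_mono)
    have "card L \<le> 2 * real m * real D" using cardL by (metis of_nat_le_iff of_nat_mult of_nat_numeral)
    also have "\<dots> \<le> 2 * real m * (real D)\<^sup>2"
      using \<open>1 \<le> D\<close> by (intro mult_left_mono) (auto simp: power2_eq_square)
    \<comment> \<open>The factor 6/5 is the value of 2m/(2m-1) at m = 3, its maximum for m \<ge> 3.
      Likewise 2m \<le> 2(2m-3) below; the two terms then sum to 18/5, which is below 4.\<close>
    also have "\<dots> \<le> (6 / 5 * (real D)\<^sup>2) * (2 * real m - 1)"
      using mult_right_mono[of "2 * real m" "6 / 5 * (2 * real m - 1)" "(real D)\<^sup>2"] m
      by (simp add: algebra_simps)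
    finally have 1: "card L / (2 * real m - 1) \<le> 6 / 5 * (real D)\<^sup>2"
      using m by (simp add: divide_le_eq)
    have "real (card Q) \<le> real ((2 * m * D)\<^sup>2)" using cardQ by (simp only: of_nat_le_iff)
    also have "\<dots> = (2 * real m * (2 * real m)) * (real D)\<^sup>2" by (simp add: power2_eq_square)
    also have "\<dots> \<le> (6 / 5 * (2 * real m - 1) * (2 * (2 * real m - 3))) * (real D)\<^sup>2"
    proof (rule mult_right_mono)
      show "2 * real m * (2 * real m) \<le> 6 / 5 * (2 * real m - 1) * (2 * (2 * real m - 3))"
        by (rule mult_mono) (use m in auto)
    qed simp
    also have "\<dots> = (12 / 5 * (real D)\<^sup>2) * ((2 * real m - 1) * (2 * real m - 3))"
      by (simp add: field_simps)
    finally have 2: "card Q / ((2 * real m - 1) * (2 * real m - 3)) \<le> 12 / 5 * (real D)\<^sup>2"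
      using m by (simp add: divide_le_eq)
    show "card L / (2 * real m - 1) + card Q / ((2 * real m - 1) * (2 * real m - 3)) \<le> 4 * (real D)\<^sup>2"
      using 1 2 zero_le_power2[of "real D"] by linarith
  qed (use N in simp)
  finally have "real (\<Sum>M\<in>PM. badness n (collapse M)) \<le> N * (4 * (real D)\<^sup>2)" .
  then show ?thesis
    using N integral_pmf_of_set[OF nePM finPM, of "\<lambda>M. real (badness n (collapse M))"]
    unfolding PM_def[symmetric] N_def[symmetric] by (simp add: divide_le_eq mult.commute)
qed

text \<open>The quotient of (m-1 choose 2) by (m choose 3) is 3/m. The constant 72 = 8 * 9 comes
  from 4D(1+D) \<le> 8D^2 and (m-1 choose 2) \<ge> m^2/9.\<close>

lemma expectation_badness_contraction_step:
  assumes "finite A" "fst ` A \<subseteq> {..<n}" "card A = 2 * m" and m: "3 \<le> m"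
    and "\<And>i. card {x \<in> A. fst x = i} \<le> D" and D: "1 \<le> D"
    and "G \<in> perfect_matchings A"
  shows "measure_pmf.expectation (contraction_step n G) (\<lambda>G'. real (badness n (collapse G')))
    \<le> (1 - 3 / real m * (1 - 72 * (real D)\<^sup>2 / real m)) * real (badness n (collapse G))"
proof -
  define c where "c = real ((m - 1) choose 2)"
  have "2 * ((m - 1) choose 2) = (m - 1) * (m - 2)"
    using Suc_times_binomial[of 1 "m - 2"] m by (simp add: numeral_2_eq_2 Suc_diff_Suc)
  then have "2 * c = real (m - 1) * real (m - 2)"
    unfolding c_def by (metis of_nat_mult of_nat_numeral)
  then have c: "c = (real m - 1) * (real m - 2) / 2"
    using m by (simp add: of_nat_diff)
  have c3: "3 * real (m choose 3) = real m * c"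
  proof -
    have "Suc (m - 1) = m" "Suc 2 = 3" using m by auto
    then have "3 * (m choose 3) = m * ((m - 1) choose 2)"
      using Suc_times_binomial[of 2 "m - 1"] by (simp only:)
    then show ?thesis unfolding c_def by (metis of_nat_mult of_nat_numeral)
  qed
  \<comment> \<open>This product is 9(m-1)(m-2) - 2m^2 in factored form, so m = 3 is the extremal
    case.\<close>
  have "0 \<le> (7 * real m - 6) * (real m - 3)" using m by (intro mult_nonneg_nonneg) auto
  then have "(real m)\<^sup>2 * 2 \<le> (real m - 1) * (real m - 2) * 9"
    by (simp add: algebra_simps power2_eq_square)
  then have c9: "(real m)\<^sup>2 / 9 \<le> c" unfolding c by simp
  have cpos: "0 < c" unfolding c using m by (intro divide_pos_pos mult_pos_pos) auto
  have "real (4 * D * (1 + D) * m) = 4 * real D * real m * (1 + real D)"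
    by (simp add: algebra_simps)
  also have "\<dots> \<le> 4 * real D * real m * (2 * real D)"
    using D by (intro mult_left_mono) auto
  also have "\<dots> = 72 * (real D)\<^sup>2 / real m * ((real m)\<^sup>2 / 9)"
    using m by (simp add: power2_eq_square)
  also have "\<dots> \<le> 72 * (real D)\<^sup>2 / real m * c"
    using c9 by (intro mult_left_mono) auto
  finally have "(1 - 72 * (real D)\<^sup>2 / real m) * c \<le> c - real (4 * D * (1 + D) * m)"
    by (simp add: left_diff_distrib)
  moreover have "real (m choose 3) = real m * c / 3" using c3 by simp
  moreover have "3 / real m * (1 - 72 * (real D)\<^sup>2 / real m) * (real m * c / 3)
      = (1 - 72 * (real D)\<^sup>2 / real m) * c" using m by simp
  moreover have "0 < real m * c / 3" using cpos m by simp
  ultimately have "3 / real m * (1 - 72 * (real D)\<^sup>2 / real m)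
      \<le> (c - real (4 * D * (1 + D) * m)) / real (m choose 3)"
    by (simp only: pos_le_divide_eq)
  then have "(1 - (c - real (4 * D * (1 + D) * m)) / real (m choose 3)) * real (badness n (collapse G))
      \<le> (1 - 3 / real m * (1 - 72 * (real D)\<^sup>2 / real m)) * real (badness n (collapse G))"
    by (intro mult_right_mono) auto
  then show ?thesis
    using contraction_step_drift[OF assms(1-5,7)] unfolding c_def by linarith
qed

section \<open>Termination\<close>

text \<open>With \<open>m \<ge> 3\<close> a triple of edges always exists, so the step never falls
  into the unspecified case of \<open>pmf_of_set\<close>.\<close>

lemma set_pmf_contraction_step:
  assumes fin: "finite A" and card: "card A = 2 * m" and m: "3 \<le> m" and G: "G \<in> perfect_matchings A"
  shows "set_pmf (contraction_step n G) \<subseteq> perfect_matchings A"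
proof (cases "badness n (collapse G) = 0")
  case True
  then show ?thesis using G by (simp add: contraction_step_def)
next
  case False
  define Ts where "Ts = {T. T \<subseteq> G \<and> card T = 3}"
  have finG: "finite G" using perfect_matching_finite[OF fin G] .
  have "card Ts = m choose 3"
    unfolding Ts_def using n_subsets[OF finG] perfect_matching_card[OF fin G] card by simp
  then have "Ts \<noteq> {}" using m zero_less_binomial[of 3 m] by (metis card.empty less_irrefl)
  moreover have "finite Ts" unfolding Ts_def using finG by simp
  moreover have "G' \<in> perfect_matchings A"
    if "T \<in> Ts" "G' \<in> set_pmf (pmf_of_set (three_swaps G T))" for T G'
    using that three_swaps_finite_nonempty[OF G fin] three_swaps_perfect_matching[OF G]
    by (auto simp: Ts_def)
  ultimately show ?thesis
    using False G unfolding contraction_step_def Ts_def[symmetric] by (auto split: if_splits)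
qed

lemma set_pmf_expand_contract:
  assumes card: "card (endpoints d) = 2 * m" and fin: "finite (endpoints d)" and m: "3 \<le> m"
  shows "set_pmf (expand_contract d t) \<subseteq> perfect_matchings (endpoints d)"
proof (induction t)
  case 0
  show ?case
    using perfect_matchings_nonempty[OF fin card] perfect_matchings_finite[OF fin] by simp
next
  case (Suc t)
  then show ?case using set_pmf_contraction_step[OF fin card m] by fastforce
qed

text \<open>Conditioning on the state after \<open>t\<close> steps, a finite sum over matchings,
  applies the one-step factor in each summand.\<close>

lemma expectation_badness_expand_contract:
  assumes card: "card (endpoints d) = 2 * m" and fin: "finite (endpoints d)" and m: "3 \<le> m"
    and deg: "\<And>i. card {x \<in> endpoints d. fst x = i} \<le> D" and D: "1 \<le> D"
  shows "measure_pmf.expectation (expand_contract d t) (\<lambda>G. real (badness (length d) (collapse G)))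
    \<le> 4 * (real D)\<^sup>2 * (1 - 3 / real m * (1 - 72 * (real D)\<^sup>2 / real m)) ^ t"
proof (induction t)
  case 0
  have "fst ` endpoints d \<subseteq> {..<length d}" by (auto simp: endpoints_def)
  then show ?case using expectation_initial_badness[OF fin _ card m deg D] by simp
next
  case (Suc t)
  define PM where "PM = perfect_matchings (endpoints d)"
  define r where "r = 1 - 3 / real m * (1 - 72 * (real D)\<^sup>2 / real m)"
  define h where "h G = real (badness (length d) (collapse G))" for G
  define p where "p = expand_contract d t"
  have vert: "fst ` endpoints d \<subseteq> {..<length d}" by (auto simp: endpoints_def)
  have finPM: "finite PM" unfolding PM_def using perfect_matchings_finite[OF fin] .
  have supp: "set_pmf p \<subseteq> PM"
    unfolding PM_def p_def using set_pmf_expand_contract[OF card fin m] .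
  \<comment> \<open>The factor must be nonnegative to multiply the induction hypothesis; it is at
    least 1 - 3/m, whatever the size of the error term.\<close>
  have "0 \<le> 3 / real m * (72 * (real D)\<^sup>2 / real m)" by simp
  moreover have "3 / real m \<le> 1" using m by simp
  ultimately have r0: "0 \<le> r" unfolding r_def right_diff_distrib mult_1_right by linarith
  have "measure_pmf.expectation (expand_contract d (Suc t)) h
      = (\<Sum>G\<in>PM. pmf p G *\<^sub>R measure_pmf.expectation (contraction_step (length d) G) h)"
    unfolding expand_contract.simps p_def[symmetric]
    using set_pmf_contraction_step[OF fin card m] finPM supp
    by (intro pmf_expectation_bind) (auto simp: PM_def intro: finite_subset)
  also have "\<dots> \<le> (\<Sum>G\<in>PM. pmf p G *\<^sub>R (r * h G))"
    unfolding r_def h_def[abs_def] PM_def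
    by (intro sum_mono scaleR_left_mono expectation_badness_contraction_step[OF fin vert card m deg D]) auto
  also have "\<dots> = r * (\<Sum>G\<in>PM. pmf p G *\<^sub>R h G)"
    by (simp add: sum_distrib_left mult.left_commute)
  also have "(\<Sum>G\<in>PM. pmf p G *\<^sub>R h G) = measure_pmf.expectation p h"
    using supp by (intro integral_measure_pmf[OF finPM, symmetric]) auto
  also have "r * \<dots> \<le> r * (4 * (real D)\<^sup>2 * r ^ t)"
    using Suc.IH r0 unfolding p_def r_def h_def[abs_def] by (rule mult_left_mono)
  finally show ?case unfolding r_def h_def[abs_def] by (simp add: mult_ac)
qed

text \<open>Markov's inequality for the integer-valued badness, with 1 - y \<le> exp(-y). The factor
  \<open>exp 1\<close> pays for rounding \<open>x\<close> down to an integer, which costs at most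
  exp(y) with y \<le> 1.\<close>

lemma prob_terminates_ge:
  assumes card: "card (endpoints d) = 2 * m" and fin: "finite (endpoints d)" and m: "3 \<le> m"
    and deg: "\<And>i. card {x \<in> endpoints d. fst x = i} \<le> D" and D: "1 \<le> D"
    and small: "72 * (real D)\<^sup>2 / real m \<le> 1" and "0 \<le> x"
  shows "1 - 4 * exp 1 * (real D)\<^sup>2 * exp (- (3 / real m * (1 - 72 * (real D)\<^sup>2 / real m) * x))
    \<le> prob_terminates_within d x"
proof -
  define p where "p = expand_contract d (nat \<lfloor>x\<rfloor>)"
  define h where "h G = real (badness (length d) (collapse G))" for G
  define y where "y = 3 / real m * (1 - 72 * (real D)\<^sup>2 / real m)"
  have y: "0 \<le> y" "y \<le> 1"
    unfolding y_def by (intro mult_nonneg_nonneg mult_le_one; use m small in simp)+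
  have "finite (perfect_matchings (endpoints d))" using perfect_matchings_finite[OF fin] .
  then have finp: "finite (set_pmf p)"
    unfolding p_def by (rule finite_subset[OF set_pmf_expand_contract[OF card fin m]])
  have "1 - measure_pmf.prob p {G. badness (length d) (collapse G) = 0}
      = measure_pmf.prob p {G. badness (length d) (collapse G) \<noteq> 0}"
    by (subst measure_pmf.prob_compl[symmetric]) (auto intro!: arg_cong[where f = "measure_pmf.prob p"])
  also have "\<dots> = measure_pmf.expectation p (indicator {G. badness (length d) (collapse G) \<noteq> 0})"
    by simp
  \<comment> \<open>A nonzero badness is at least 1, so the indicator lies below
    \<open>h\<close>.\<close>
  also have "\<dots> \<le> measure_pmf.expectation p h"
    by (intro integral_mono integrable_measure_pmf_finite finp)
      (auto simp: h_def indicator_def)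
  also have "\<dots> \<le> 4 * (real D)\<^sup>2 * (1 - y) ^ nat \<lfloor>x\<rfloor>"
    unfolding p_def h_def[abs_def] y_def by (rule expectation_badness_expand_contract[OF card fin m deg D])
  also have "\<dots> \<le> 4 * (real D)\<^sup>2 * (exp 1 * exp (- (y * x)))"
  proof (rule mult_left_mono)
    have "(1 - y) ^ nat \<lfloor>x\<rfloor> \<le> exp (- y) ^ nat \<lfloor>x\<rfloor>"
      using y exp_ge_add_one_self[of "- y"] by (intro power_mono) auto
    also have "\<dots> = exp (- (real (nat \<lfloor>x\<rfloor>) * y))"
      by (simp add: exp_of_nat_mult[symmetric])
    also have "\<dots> \<le> exp (1 - y * x)"
    proof -
      have "x - 1 \<le> real (nat \<lfloor>x\<rfloor>)" using \<open>0 \<le> x\<close> by linarith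
      then have "y * (x - 1) \<le> y * real (nat \<lfloor>x\<rfloor>)" using y by (intro mult_left_mono) auto
      then show ?thesis using y by (simp add: algebra_simps)
    qed
    also have "\<dots> = exp 1 * exp (- (y * x))" by (simp add: exp_add[symmetric])
    finally show "(1 - y) ^ nat \<lfloor>x\<rfloor> \<le> exp 1 * exp (- (y * x))" .
  qed simp
  finally show ?thesis
    unfolding prob_terminates_within_def p_def[symmetric] y_def by (simp add: mult_ac)
qed

section \<open>The endpoint set of a degree sequence\<close>

lemma endpoints_eq_Sigma: "endpoints d = (SIGMA i:{..<length d}. {..<d ! i})"
  by (auto simp: endpoints_def)

lemma finite_endpoints: "finite (endpoints d)"
  by (simp add: endpoints_eq_Sigma)

lemma card_endpoints: "card (endpoints d) = sum_list d"
  by (simp add: endpoints_eq_Sigma sum_list_sum_nth atLeast0LessThan)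

lemma card_endpoints_at_le:
  assumes "sorted d"
  shows "card {x \<in> endpoints d. fst x = i} \<le> last d"
proof (cases "i < length d")
  case True
  then have "{x \<in> endpoints d. fst x = i} = Pair i ` {..<d ! i}"
    by (auto simp: endpoints_def)
  then have "card {x \<in> endpoints d. fst x = i} = d ! i"
    by (simp add: card_image inj_on_def)
  also have "\<dots> \<le> last d"
    using True assms by (subst last_conv_nth) (auto intro!: sorted_nth_mono)
  finally show ?thesis .
next
  case False
  then have "{x \<in> endpoints d. fst x = i} = {}" by (auto simp: endpoints_def)
  then show ?thesis by (simp only: card.empty le0)
qed

text \<open>Handshake argument: counting incidences edge by edge gives 2 per edge. It makes
  \<open>num_edges\<close> an integer, as the matching counts require.\<close>

lemma graphical_even_sum:
  assumes "graphical d"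
  shows "even (sum_list d)"
proof -
  obtain E where E: "E \<subseteq> {e. e \<subseteq> {..<length d} \<and> card e = 2}"
    and deg: "\<And>i. i < length d \<Longrightarrow> card {e \<in> E. i \<in> e} = d ! i"
    using assms unfolding graphical_def by auto
  have finE: "finite E" by (rule finite_subset[of _ "Pow {..<length d}"]) (use E in auto)
  have "sum_list d = (\<Sum>i<length d. card {e \<in> E. i \<in> e})"
    using deg by (simp add: sum_list_sum_nth atLeast0LessThan)
  also have "\<dots> = (\<Sum>e\<in>E. card {i \<in> {..<length d}. i \<in> e})"
    using finE by (intro sum_card_filter_swap) auto
  also have "\<dots> = (\<Sum>e\<in>E. 2)"
  proof (rule sum.cong[OF refl])
    fix e assume "e \<in> E"
    then have "{i \<in> {..<length d}. i \<in> e} = e" "card e = 2" using E by auto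
    then show "card {i \<in> {..<length d}. i \<in> e} = 2" by simp
  qed
  finally show ?thesis by simp
qed

theorem theorem4:
  fixes d :: "nat \<Rightarrow> nat list"
  assumes "\<And>k. sorted (d k)"
    and "\<And>k. graphical (d k)"
    and "filterlim (\<lambda>k. num_edges (d k)) at_top sequentially"
    and "(\<lambda>k. real (last (d k))) \<in> o(\<lambda>k. sqrt (num_edges (d k)))"
    and "filterlim (\<lambda>k. last (d k)) at_top sequentially"
  shows "\<exists>\<epsilon> :: nat \<Rightarrow> real. \<epsilon> \<longlonglongrightarrow> 0 \<and>
    (\<lambda>k. prob_terminates_within (d k)
           ((1 + \<epsilon> k) * (2 / 3 * num_edges (d k) * ln (real (last (d k)))))) \<longlonglongrightarrow> 1"
proof -
  define D where "D k = last (d k)" for k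
  define m where "m k = num_edges (d k)" for k
  \<comment> \<open>\<open>\<delta>\<close> is the relative loss in the one-step drift.
    \<open>\<eta>\<close> is slack that tends to 0 although
    \<open>\<eta> k * ln (real (D k))\<close> still tends to infinity. \<open>\<epsilon>\<close> is
    solved from (1 + \<open>\<epsilon>\<close>)(1 - \<open>\<delta>\<close>) = 1 +
    \<open>\<eta>\<close>.\<close>
  define \<delta> where "\<delta> k = 72 * (real (D k))\<^sup>2 / m k" for k
  define \<eta> where "\<eta> k = 1 / sqrt (ln (real (D k)))" for k
  define \<epsilon> where "\<epsilon> k = (1 + \<eta> k) / (1 - \<delta> k) - 1" for k
  define x where "x k = (1 + \<epsilon> k) * (2 / 3 * m k * ln (real (D k)))" for k
  have m_inf: "filterlim m at_top sequentially" using assms(3) unfolding m_def[abs_def] .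
  have D_inf: "filterlim (\<lambda>k. real (D k)) at_top sequentially"
    unfolding D_def by (rule filterlim_compose[OF filterlim_real_sequentially assms(5)])
  have ln_inf: "filterlim (\<lambda>k. ln (real (D k))) at_top sequentially"
    by (rule filterlim_compose[OF ln_at_top D_inf])
  have sqrt_inf: "filterlim (\<lambda>k. sqrt (ln (real (D k)))) at_top sequentially"
    by (rule filterlim_compose[OF sqrt_at_top ln_inf])
  have \<eta>_lim: "\<eta> \<longlonglongrightarrow> 0"
    unfolding \<eta>_def[abs_def] by (rule real_tendsto_divide_at_top[OF tendsto_const sqrt_inf])
  have \<delta>_lim: "\<delta> \<longlonglongrightarrow> 0"
  proof -
    have "(\<lambda>k. real (D k) / sqrt (m k)) \<longlonglongrightarrow> 0"
      using smalloD_tendsto[OF assms(4)] unfolding D_def m_def .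
    then have "(\<lambda>k. 72 * (real (D k) / sqrt (m k))\<^sup>2) \<longlonglongrightarrow> 72 * 0\<^sup>2"
      by (intro tendsto_intros)
    then have "(\<lambda>k. 72 * (real (D k) / sqrt (m k))\<^sup>2) \<longlonglongrightarrow> 0" by simp
    moreover have "\<forall>\<^sub>F k in sequentially. 72 * (real (D k) / sqrt (m k))\<^sup>2 = \<delta> k"
      using filterlim_at_top_dense[THEN iffD1, OF m_inf, rule_format, of 0]
      by eventually_elim (simp add: \<delta>_def power_divide)
    ultimately show ?thesis by (rule Lim_transform_eventually)
  qed
  have "(\<lambda>k. (1 + \<eta> k) / (1 - \<delta> k) - 1) \<longlonglongrightarrow> (1 + 0) / (1 - 0) - 1"
    by (intro tendsto_intros \<eta>_lim \<delta>_lim) simp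
  then have \<epsilon>_lim: "\<epsilon> \<longlonglongrightarrow> 0" unfolding \<epsilon>_def[abs_def] by simp
  \<comment> \<open>Eventually m > 3, D > 1 and \<open>\<delta>\<close> < 1, which gives enough
    edges, a positive logarithm and a positive drift.\<close>
  have lower: "\<forall>\<^sub>F k in sequentially.
      1 - 4 * exp 1 * exp (- (2 * sqrt (ln (real (D k))))) \<le> prob_terminates_within (d k) (x k)"
    using filterlim_at_top_dense[THEN iffD1, OF m_inf, rule_format, of 3]
      filterlim_at_top_dense[THEN iffD1, OF D_inf, rule_format, of 1]
      order_tendstoD(2)[OF \<delta>_lim zero_less_one]
  proof eventually_elim
    case (elim k)
    obtain j where j: "sum_list (d k) = 2 * j"
      using graphical_even_sum[OF assms(2)] by (auto elim: evenE)
    have mj: "m k = real j" by (simp add: m_def num_edges_def j)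
    have lnD: "0 < ln (real (D k))" using elim by simp
    have \<delta>: "0 < 1 - \<delta> k" using elim by simp
    have e: "1 + \<epsilon> k = (1 + \<eta> k) / (1 - \<delta> k)" by (simp add: \<epsilon>_def)
    have "0 \<le> \<eta> k" using lnD by (simp add: \<eta>_def)
    then have "0 \<le> x k" unfolding x_def e using lnD \<delta> elim by simp
    then have "1 - 4 * exp 1 * (real (D k))\<^sup>2 * exp (- (3 / real j * (1 - 72 * (real (D k))\<^sup>2 / real j) * x k))
        \<le> prob_terminates_within (d k) (x k)"
      using elim mj card_endpoints_at_le[OF assms(1), of k] unfolding D_def[symmetric] \<delta>_def
      by (intro prob_terminates_ge) (auto simp: card_endpoints j finite_endpoints)
    \<comment> \<open>The first term of this exponent cancels the factor D^2 from the initial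
      badness; the second, produced by \<open>\<eta>\<close>, remains as the decay of the failure
      probability.\<close>
    moreover have "3 / real j * (1 - 72 * (real (D k))\<^sup>2 / real j) * x k
        = 2 * ln (real (D k)) + 2 * sqrt (ln (real (D k)))"
    proof -
      have "3 / m k * (1 - \<delta> k) * x k = 2 * (1 + \<eta> k) * ln (real (D k))"
      proof -
        have cancel: "3 / u * v * (w / v * (2 / 3 * u * l)) = 2 * w * l" if "u \<noteq> 0" "v \<noteq> 0"
          for u v w l :: real
          using that by (simp add: field_simps)
        show ?thesis unfolding x_def e by (rule cancel) (use elim \<delta> in auto)
      qed
      also have "\<dots> = 2 * ln (real (D k)) + 2 * (ln (real (D k)) / sqrt (ln (real (D k))))"
        by (simp add: \<eta>_def algebra_simps)
      finally show ?thesis using lnD by (simp add: \<delta>_def mj real_div_sqrt)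
    qed
    moreover have "exp (- (2 * ln (real (D k)) + 2 * sqrt (ln (real (D k)))))
        = exp (- (2 * sqrt (ln (real (D k))))) / (real (D k))\<^sup>2"
    proof -
      have "exp (2 * ln (real (D k))) = (real (D k))\<^sup>2"
        using elim by (simp add: exp_double)
      then show ?thesis by (simp add: exp_diff exp_minus divide_inverse exp_add mult_ac)
    qed
    ultimately show ?case using elim by simp
  qed
  \<comment> \<open>The divergence of the maximum degree drives the remaining failure bound to
    0.\<close>
  have "filterlim (\<lambda>k. - (2 * sqrt (ln (real (D k))))) at_bot sequentially"
    using filterlim_tendsto_pos_mult_at_top[OF tendsto_const _ sqrt_inf, of 2]
    by (simp add: filterlim_uminus_at_top)
  then have "(\<lambda>k. exp (- (2 * sqrt (ln (real (D k)))))) \<longlonglongrightarrow> 0"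
    by (rule filterlim_compose[OF exp_at_bot])
  then have "(\<lambda>k. 1 - 4 * exp 1 * exp (- (2 * sqrt (ln (real (D k)))))) \<longlonglongrightarrow> 1 - 4 * exp 1 * 0"
    by (intro tendsto_intros)
  then have lower_lim: "(\<lambda>k. 1 - 4 * exp 1 * exp (- (2 * sqrt (ln (real (D k)))))) \<longlonglongrightarrow> 1" by simp
  have "(\<lambda>k. prob_terminates_within (d k) (x k)) \<longlonglongrightarrow> 1"
    by (rule tendsto_sandwich[OF lower _ lower_lim tendsto_const])
      (simp add: prob_terminates_within_def measure_pmf.prob_le_1)
  with \<epsilon>_lim show ?thesis unfolding x_def m_def D_def by blast
qed

end
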